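(* Let $G$ be a subgroup separable group, $H$ a finitely generated subgroup of $G$, and $\alpha$ an inner automorphism of $G$ such that $\alpha(H)=H$. Then: (1) $\mathrm{Alex}(H,\alpha|_H)$ is a separable subquandle of $\mathrm{Alex}(G,\alpha)$. (2) $\mathrm{Conj}(H,\alpha|_H)$ is a separable subquandle of $\mathrm{Conj}(G,\alpha)$.
   Context: A quandle is a set $X$ with a binary operation $*$ such that: (1) $x*x=x$ for all $x$; (2) for all $x,y \in X$ there is a unique $z\in X$ with $x=z*y$; (3) $(x*y)*z=(x*z)*(y*z)$ for all $x,y,z$. For a group $G$ and $\alpha\in\mathrm{Aut}(G)$: the generalized Alexander quandle $\mathrm{Alex}(G,\alpha)$ is the set $G$ with operation $x*y=\alpha(xy^{-1})y$; the twisted conjugation quandle $\mathrm{Conj}(G,\alpha)$ is the set $G$ with operation $x*y=\alpha(y^{-1}x)y$. A subset $S$ of a group (respectively quandle) $X$ is separable in $X$ if for each $x\in X\setminus S$ there exist a finite group (respectively finite quandle) $F$ and a group (respectively quandle) homomorphism $\phi:X\to F$ with $\phi(x)\notin\phi(S)$. A group is subgroup separable if each of its finitely generated subgroups is separable. *)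

theory Defs
  imports "HOL-Algebra.Generated_Groups"
begin

section \<open>Quandles\<close>

record 'a quandle = "'a partial_object" +
  qop :: "'a \<Rightarrow> 'a \<Rightarrow> 'a" (infixl \<open>\<star>\<index>\<close> 70)

locale quandle =
  fixes Q :: "('a, 'b) quandle_scheme" (structure)
  assumes closed: "\<lbrakk>x \<in> carrier Q; y \<in> carrier Q\<rbrakk> \<Longrightarrow> x \<star> y \<in> carrier Q"
    and idem: "x \<in> carrier Q \<Longrightarrow> x \<star> x = x"
    and right_div: "\<lbrakk>x \<in> carrier Q; y \<in> carrier Q\<rbrakk> \<Longrightarrow> \<exists>!z. z \<in> carrier Q \<and> x = z \<star> y"
    and right_distrib:
      "\<lbrakk>x \<in> carrier Q; y \<in> carrier Q; z \<in> carrier Q\<rbrakk>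
        \<Longrightarrow> (x \<star> y) \<star> z = (x \<star> z) \<star> (y \<star> z)"

definition quandle_hom ::
  "('a, 'c) quandle_scheme \<Rightarrow> ('b, 'd) quandle_scheme \<Rightarrow> ('a \<Rightarrow> 'b) set" where
  "quandle_hom Q R = {f. f \<in> carrier Q \<rightarrow> carrier R \<and>
     (\<forall>x\<in>carrier Q. \<forall>y\<in>carrier Q. f (x \<star>\<^bsub>Q\<^esub> y) = f x \<star>\<^bsub>R\<^esub> f y)}"

definition subquandle :: "('a, 'c) quandle_scheme \<Rightarrow> ('a, 'b) quandle_scheme \<Rightarrow> bool" where
  "subquandle S Q \<longleftrightarrow> quandle S \<and> quandle Q \<and> carrier S \<subseteq> carrier Q \<and>
     (\<forall>x\<in>carrier S. \<forall>y\<in>carrier S. x \<star>\<^bsub>S\<^esub> y = x \<star>\<^bsub>Q\<^esub> y)"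

text \<open>
  The operations are only meaningful for a group \<open>G\<close> and an automorphism \<open>\<alpha>\<close> of \<open>G\<close>;
  see \<open>Alex_quandle\<close> and \<open>Conj_quandle\<close> below.
\<close>

definition Alex :: "('a, 'b) monoid_scheme \<Rightarrow> ('a \<Rightarrow> 'a) \<Rightarrow> 'a quandle" where
  "Alex G \<alpha> = \<lparr>carrier = carrier G,
     qop = (\<lambda>x y. \<alpha> (x \<otimes>\<^bsub>G\<^esub> inv\<^bsub>G\<^esub> y) \<otimes>\<^bsub>G\<^esub> y)\<rparr>"

definition Conj :: "('a, 'b) monoid_scheme \<Rightarrow> ('a \<Rightarrow> 'a) \<Rightarrow> 'a quandle" where
  "Conj G \<alpha> = \<lparr>carrier = carrier G,
     qop = (\<lambda>x y. \<alpha> (inv\<^bsub>G\<^esub> y \<otimes>\<^bsub>G\<^esub> x) \<otimes>\<^bsub>G\<^esub> y)\<rparr>"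

lemma (in group) Alex_quandle:
  assumes "\<alpha> \<in> iso G G"
  shows "quandle (Alex G \<alpha>)"
proof -
  have hom: "\<alpha> \<in> hom G G" and bij: "bij_betw \<alpha> (carrier G) (carrier G)"
    using assms by (auto simp: iso_def)
  interpret \<alpha>: group_hom G G \<alpha>
    by unfold_locales (rule hom)
  show ?thesis
  proof
    fix x y assume "x \<in> carrier (Alex G \<alpha>)" "y \<in> carrier (Alex G \<alpha>)"
    then have x: "x \<in> carrier G" and y: "y \<in> carrier G"
      by (auto simp: Alex_def)
    have eq: "x = \<alpha> (z \<otimes> inv y) \<otimes> y \<longleftrightarrow> \<alpha> (z \<otimes> inv y) = x \<otimes> inv y" if "z \<in> carrier G" for z
      using x y that by (metis \<alpha>.hom_closed inv_closed inv_solve_right m_closed)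
    obtain w where w: "w \<in> carrier G" "\<alpha> w = x \<otimes> inv y"
      using bij x y by (metis bij_betw_iff_bijections inv_closed m_closed)
    have "\<exists>!z. z \<in> carrier G \<and> x = \<alpha> (z \<otimes> inv y) \<otimes> y"
    proof (rule ex1I[of _ "w \<otimes> y"])
      show "w \<otimes> y \<in> carrier G \<and> x = \<alpha> (w \<otimes> y \<otimes> inv y) \<otimes> y"
        using w x y by (simp add: m_assoc)
      fix z assume z: "z \<in> carrier G \<and> x = \<alpha> (z \<otimes> inv y) \<otimes> y"
      then have "\<alpha> (z \<otimes> inv y) = \<alpha> w" using eq[of z] z w by metis
      then have "z \<otimes> inv y = w"
        using bij w z y by (auto simp: bij_betw_def inj_on_def)
      then show "z = w \<otimes> y" using z y by (auto simp: m_assoc)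
    qed
    then show "\<exists>!z. z \<in> carrier (Alex G \<alpha>) \<and> x = z \<star>\<^bsub>Alex G \<alpha>\<^esub> y"
      by (simp add: Alex_def)
  next
    fix x y z
    assume "x \<in> carrier (Alex G \<alpha>)" "y \<in> carrier (Alex G \<alpha>)" "z \<in> carrier (Alex G \<alpha>)"
    then have [simp]: "x \<in> carrier G" "y \<in> carrier G" "z \<in> carrier G"
      by (auto simp: Alex_def)
    have c: "inv a \<otimes> (a \<otimes> b) = b" "a \<otimes> (inv a \<otimes> b) = b"
      if "a \<in> carrier G" "b \<in> carrier G" for a b
      using that by (simp_all flip: m_assoc)
    show "(x \<star>\<^bsub>Alex G \<alpha>\<^esub> y) \<star>\<^bsub>Alex G \<alpha>\<^esub> z =
        (x \<star>\<^bsub>Alex G \<alpha>\<^esub> z) \<star>\<^bsub>Alex G \<alpha>\<^esub> (y \<star>\<^bsub>Alex G \<alpha>\<^esub> z)"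
      by (simp add: Alex_def m_assoc inv_mult_group c)
  qed (auto simp: Alex_def)
qed

lemma (in group) Conj_quandle:
  assumes "\<alpha> \<in> iso G G"
  shows "quandle (Conj G \<alpha>)"
proof -
  have hom: "\<alpha> \<in> hom G G" and bij: "bij_betw \<alpha> (carrier G) (carrier G)"
    using assms by (auto simp: iso_def)
  interpret \<alpha>: group_hom G G \<alpha>
    by unfold_locales (rule hom)
  show ?thesis
  proof
    fix x y assume "x \<in> carrier (Conj G \<alpha>)" "y \<in> carrier (Conj G \<alpha>)"
    then have x: "x \<in> carrier G" and y: "y \<in> carrier G"
      by (auto simp: Conj_def)
    have eq: "x = \<alpha> (inv y \<otimes> z) \<otimes> y \<longleftrightarrow> \<alpha> (inv y \<otimes> z) = x \<otimes> inv y" if "z \<in> carrier G" for z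
      using x y that by (metis \<alpha>.hom_closed inv_closed inv_solve_right m_closed)
    obtain w where w: "w \<in> carrier G" "\<alpha> w = x \<otimes> inv y"
      using bij x y by (metis bij_betw_iff_bijections inv_closed m_closed)
    have "\<exists>!z. z \<in> carrier G \<and> x = \<alpha> (inv y \<otimes> z) \<otimes> y"
    proof (rule ex1I[of _ "y \<otimes> w"])
      show "y \<otimes> w \<in> carrier G \<and> x = \<alpha> (inv y \<otimes> (y \<otimes> w)) \<otimes> y"
        using w x y by (simp add: m_assoc flip: m_assoc[of "inv y" y w])
      fix z assume z: "z \<in> carrier G \<and> x = \<alpha> (inv y \<otimes> z) \<otimes> y"
      then have "\<alpha> (inv y \<otimes> z) = \<alpha> w" using eq[of z] z w by metis
      then have "inv y \<otimes> z = w"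
        using bij w z y by (auto simp: bij_betw_def inj_on_def)
      then show "z = y \<otimes> w" using z y by (auto simp flip: m_assoc)
    qed
    then show "\<exists>!z. z \<in> carrier (Conj G \<alpha>) \<and> x = z \<star>\<^bsub>Conj G \<alpha>\<^esub> y"
      by (simp add: Conj_def)
  next
    fix x y z
    assume "x \<in> carrier (Conj G \<alpha>)" "y \<in> carrier (Conj G \<alpha>)" "z \<in> carrier (Conj G \<alpha>)"
    then have [simp]: "x \<in> carrier G" "y \<in> carrier G" "z \<in> carrier G"
      by (auto simp: Conj_def)
    have c: "inv a \<otimes> (a \<otimes> b) = b" "a \<otimes> (inv a \<otimes> b) = b"
      if "a \<in> carrier G" "b \<in> carrier G" for a b
      using that by (simp_all flip: m_assoc)
    show "(x \<star>\<^bsub>Conj G \<alpha>\<^esub> y) \<star>\<^bsub>Conj G \<alpha>\<^esub> z =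
        (x \<star>\<^bsub>Conj G \<alpha>\<^esub> z) \<star>\<^bsub>Conj G \<alpha>\<^esub> (y \<star>\<^bsub>Conj G \<alpha>\<^esub> z)"
      by (simp add: Conj_def m_assoc inv_mult_group c)
  qed (auto simp: Conj_def)
qed


section \<open>Separability\<close>

text \<open>
  HOL cannot quantify existentially over types, so the finite target ranges over structures
  whose carrier is a finite set of natural numbers.  This is no restriction, as every finite
  group or quandle has an isomorphic copy of this kind; see \<open>group_separableI\<close> and
  \<open>quandle_separableI\<close>.
\<close>

definition group_separable :: "'a set \<Rightarrow> ('a, 'b) monoid_scheme \<Rightarrow> bool" where
  "group_separable S G \<longleftrightarrow> S \<subseteq> carrier G \<and>
     (\<forall>x\<in>carrier G - S. \<exists>(F :: nat monoid) \<phi>.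
        group F \<and> finite (carrier F) \<and> \<phi> \<in> hom G F \<and> \<phi> x \<notin> \<phi> ` S)"

definition quandle_separable :: "'a set \<Rightarrow> ('a, 'b) quandle_scheme \<Rightarrow> bool" where
  "quandle_separable S Q \<longleftrightarrow> S \<subseteq> carrier Q \<and>
     (\<forall>x\<in>carrier Q - S. \<exists>(F :: nat quandle) \<phi>.
        quandle F \<and> finite (carrier F) \<and> \<phi> \<in> quandle_hom Q F \<and> \<phi> x \<notin> \<phi> ` S)"

lemma group_separableI:
  fixes F :: "'a \<Rightarrow> ('c, 'd) monoid_scheme" and \<phi> :: "'a \<Rightarrow> 'a \<Rightarrow> 'c"
  assumes "S \<subseteq> carrier G"
    and F: "\<And>x. x \<in> carrier G - S \<Longrightarrow>
      group (F x) \<and> finite (carrier (F x)) \<and> \<phi> x \<in> hom G (F x) \<and> \<phi> x x \<notin> \<phi> x ` S"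
  shows "group_separable S G"
  unfolding group_separable_def
proof (intro conjI ballI)
  fix x assume x: "x \<in> carrier G - S"
  interpret F: group "F x" using F x by blast
  obtain e :: "'c \<Rightarrow> nat" where e: "inj_on e (carrier (F x))"
    using F x by (metis finite_imp_inj_to_nat_seg)
  define d where "d = the_inv_into (carrier (F x)) e"
  have d: "d (e a) = a" if "a \<in> carrier (F x)" for a
    using that e by (simp add: d_def the_inv_into_f_f)
  define F' where "F' = \<lparr>carrier = e ` carrier (F x),
    mult = (\<lambda>a b. e (d a \<otimes>\<^bsub>F x\<^esub> d b)), one = e \<one>\<^bsub>F x\<^esub>\<rparr>"
  have "group F'"
  proof (rule groupI)
    fix a assume "a \<in> carrier F'"
    then obtain b where "b \<in> carrier (F x)" "a = e b" by (auto simp: F'_def)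
    then show "\<exists>y\<in>carrier F'. y \<otimes>\<^bsub>F'\<^esub> a = \<one>\<^bsub>F'\<^esub>"
      by (intro bexI[of _ "e (inv\<^bsub>F x\<^esub> b)"]) (auto simp: F'_def d)
  qed (auto simp: F'_def d F.m_assoc)
  moreover have "finite (carrier F')" using F x by (simp add: F'_def)
  moreover have cl: "\<phi> x a \<in> carrier (F x)" if "a \<in> carrier G" for a
    using F[OF x] that by (auto simp: hom_def)
  then have "e \<circ> \<phi> x \<in> hom G F'"
    using F[OF x] by (auto simp: hom_def F'_def d)
  moreover have "(e \<circ> \<phi> x) x \<notin> (e \<circ> \<phi> x) ` S"
  proof
    assume "(e \<circ> \<phi> x) x \<in> (e \<circ> \<phi> x) ` S"
    then obtain s where "s \<in> S" "e (\<phi> x x) = e (\<phi> x s)" by auto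
    then have "\<phi> x x = \<phi> x s" using d cl x assms(1) by (metis DiffD1 subsetD)
    then show False using F x \<open>s \<in> S\<close> by blast
  qed
  ultimately show "\<exists>(F :: nat monoid) \<phi>.
      group F \<and> finite (carrier F) \<and> \<phi> \<in> hom G F \<and> \<phi> x \<notin> \<phi> ` S"
    by blast
qed (rule assms(1))

lemma quandle_separableI:
  fixes F :: "'a \<Rightarrow> ('c, 'd) quandle_scheme" and \<phi> :: "'a \<Rightarrow> 'a \<Rightarrow> 'c"
  assumes "S \<subseteq> carrier Q"
    and F: "\<And>x. x \<in> carrier Q - S \<Longrightarrow>
      quandle (F x) \<and> finite (carrier (F x)) \<and> \<phi> x \<in> quandle_hom Q (F x) \<and> \<phi> x x \<notin> \<phi> x ` S"
  shows "quandle_separable S Q"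
  unfolding quandle_separable_def
proof (intro conjI ballI)
  fix x assume x: "x \<in> carrier Q - S"
  interpret F: quandle "F x" using F x by blast
  obtain e :: "'c \<Rightarrow> nat" where e: "inj_on e (carrier (F x))"
    using F x by (metis finite_imp_inj_to_nat_seg)
  define d where "d = the_inv_into (carrier (F x)) e"
  have d: "d (e a) = a" if "a \<in> carrier (F x)" for a
    using that e by (simp add: d_def the_inv_into_f_f)
  define F' where "F' = \<lparr>carrier = e ` carrier (F x), qop = (\<lambda>a b. e (d a \<star>\<^bsub>F x\<^esub> d b))\<rparr>"
  have "quandle F'"
  proof
    fix a b assume "a \<in> carrier F'" "b \<in> carrier F'"
    then obtain a' b' where ab: "a' \<in> carrier (F x)" "a = e a'" "b' \<in> carrier (F x)" "b = e b'"
      by (auto simp: F'_def)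
    then obtain c where c: "c \<in> carrier (F x)" "a' = c \<star>\<^bsub>F x\<^esub> b'"
      "\<And>c'. c' \<in> carrier (F x) \<Longrightarrow> a' = c' \<star>\<^bsub>F x\<^esub> b' \<Longrightarrow> c' = c"
      using F.right_div by metis
    show "\<exists>!z. z \<in> carrier F' \<and> a = z \<star>\<^bsub>F'\<^esub> b"
    proof (rule ex1I[of _ "e c"])
      show "e c \<in> carrier F' \<and> a = e c \<star>\<^bsub>F'\<^esub> b"
        using ab c(1,2) by (simp add: F'_def d)
      fix z assume z: "z \<in> carrier F' \<and> a = z \<star>\<^bsub>F'\<^esub> b"
      then obtain z' where z': "z' \<in> carrier (F x)" "z = e z'" by (auto simp: F'_def)
      with z ab have "e a' = e (z' \<star>\<^bsub>F x\<^esub> b')" by (simp add: F'_def d)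
      then have "a' = z' \<star>\<^bsub>F x\<^esub> b'" using ab z' d F.closed by metis
      then show "z = e c" using c(3) z' by simp
    qed
  next
    fix a b c assume "a \<in> carrier F'" "b \<in> carrier F'" "c \<in> carrier F'"
    then show "a \<star>\<^bsub>F'\<^esub> b \<star>\<^bsub>F'\<^esub> c = a \<star>\<^bsub>F'\<^esub> c \<star>\<^bsub>F'\<^esub> (b \<star>\<^bsub>F'\<^esub> c)"
      by (auto simp: F'_def d F.closed intro!: arg_cong[where f = e] F.right_distrib)
  qed (auto simp: F'_def d F.closed F.idem)
  moreover have "finite (carrier F')" using F x by (simp add: F'_def)
  moreover have cl: "\<phi> x a \<in> carrier (F x)" if "a \<in> carrier Q" for a
    using F[OF x] that by (auto simp: quandle_hom_def)
  then have "e \<circ> \<phi> x \<in> quandle_hom Q F'"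
    using F[OF x] by (auto simp: quandle_hom_def F'_def d)
  moreover have "(e \<circ> \<phi> x) x \<notin> (e \<circ> \<phi> x) ` S"
  proof
    assume "(e \<circ> \<phi> x) x \<in> (e \<circ> \<phi> x) ` S"
    then obtain s where "s \<in> S" "e (\<phi> x x) = e (\<phi> x s)" by auto
    then have "\<phi> x x = \<phi> x s" using d cl x assms(1) by (metis DiffD1 subsetD)
    then show False using F x \<open>s \<in> S\<close> by blast
  qed
  ultimately show "\<exists>(F :: nat quandle) \<phi>.
      quandle F \<and> finite (carrier F) \<and> \<phi> \<in> quandle_hom Q F \<and> \<phi> x \<notin> \<phi> ` S"
    by blast
qed (rule assms(1))

definition finitely_generated_subgroup :: "'a set \<Rightarrow> ('a, 'b) monoid_scheme \<Rightarrow> bool" where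
  "finitely_generated_subgroup H G \<longleftrightarrow> subgroup H G \<and>
     (\<exists>A. finite A \<and> A \<subseteq> carrier G \<and> H = generate G A)"

definition subgroup_separable :: "('a, 'b) monoid_scheme \<Rightarrow> bool" where
  "subgroup_separable G \<longleftrightarrow> group G \<and>
     (\<forall>H. finitely_generated_subgroup H G \<longrightarrow> group_separable H G)"

definition inner_automorphism :: "('a \<Rightarrow> 'a) \<Rightarrow> ('a, 'b) monoid_scheme \<Rightarrow> bool" where
  "inner_automorphism \<alpha> G \<longleftrightarrow> \<alpha> \<in> iso G G \<and>
     (\<exists>g\<in>carrier G. \<forall>x\<in>carrier G. \<alpha> x = g \<otimes>\<^bsub>G\<^esub> x \<otimes>\<^bsub>G\<^esub> inv\<^bsub>G\<^esub> g)"

end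

theory Submission
  imports Defs
begin

text \<open>
  The point of assuming \<open>\<alpha>\<close> inner is that it descends along every group homomorphism: if
  \<open>\<alpha>\<close> is conjugation by \<open>g\<close> and \<open>\<phi> : G \<rightarrow> F\<close>, then conjugation by \<open>\<phi> g\<close> is an automorphism
  \<open>\<beta>\<close> of \<open>F\<close> with \<open>\<phi> \<circ> \<alpha> = \<beta> \<circ> \<phi>\<close>, even when \<open>\<phi>\<close> is not onto
  (\<open>inner_automorphism_push\<close>). Since the operations of \<open>Alex\<close> and \<open>Conj\<close> are words in the group
  operations and the automorphism, \<open>\<phi>\<close> itself is then a homomorphism \<open>Alex(G, \<alpha>) \<rightarrow> Alex(F, \<beta>)\<close>
  and \<open>Conj(G, \<alpha>) \<rightarrow> Conj(F, \<beta>)\<close>. Hence a finite group separating a point from \<open>H\<close> carries finite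
  quandles separating that point from \<open>H\<close> by the same map, and separability of the finitely
  generated subgroup \<open>H\<close> in \<open>G\<close> gives separability in both quandles.
\<close>

lemma carrier_Alex: "carrier (Alex G \<alpha>) = carrier G"
  by (simp add: Alex_def)

lemma carrier_Conj: "carrier (Conj G \<alpha>) = carrier G"
  by (simp add: Conj_def)

lemma (in group) conjugation_iso:
  assumes [simp]: "g \<in> carrier G"
  shows "(\<lambda>x. g \<otimes> x \<otimes> inv g) \<in> iso G G"
proof -
  have cancel: "inv a \<otimes> (a \<otimes> b) = b" "a \<otimes> (inv a \<otimes> b) = b"
    if "a \<in> carrier G" "b \<in> carrier G" for a b
    using that by (simp_all flip: m_assoc)
  have "bij_betw (\<lambda>x. g \<otimes> x \<otimes> inv g) (carrier G) (carrier G)"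
    by (rule bij_betw_byWitness[where f' = "\<lambda>x. inv g \<otimes> x \<otimes> g"]) (auto simp: m_assoc cancel)
  then show ?thesis
    by (auto simp: iso_def hom_def m_assoc cancel)
qed

lemma inner_automorphism_push:
  assumes "group G" and "group F" and hom: "\<phi> \<in> hom G F" and "inner_automorphism \<alpha> G"
  obtains \<beta> where "\<beta> \<in> iso F F" and "\<And>x. x \<in> carrier G \<Longrightarrow> \<phi> (\<alpha> x) = \<beta> (\<phi> x)"
proof -
  interpret \<phi>: group_hom G F \<phi>
    using assms by (simp add: group_hom_def group_hom_axioms_def)
  obtain g where g: "g \<in> carrier G"
    and \<alpha>: "\<And>x. x \<in> carrier G \<Longrightarrow> \<alpha> x = g \<otimes>\<^bsub>G\<^esub> x \<otimes>\<^bsub>G\<^esub> inv\<^bsub>G\<^esub> g"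
    using assms(4) unfolding inner_automorphism_def by blast
  show thesis
  proof (rule that)
    show "(\<lambda>y. \<phi> g \<otimes>\<^bsub>F\<^esub> y \<otimes>\<^bsub>F\<^esub> inv\<^bsub>F\<^esub> \<phi> g) \<in> iso F F"
      using g by (simp add: \<phi>.H.conjugation_iso)
  qed (use g in \<open>simp add: \<alpha>\<close>)
qed

lemma (in group_hom) equivariant_quandle_hom:
  assumes "\<alpha> \<in> hom G G" and "\<And>x. x \<in> carrier G \<Longrightarrow> h (\<alpha> x) = \<beta> (h x)"
  shows "h \<in> quandle_hom (Alex G \<alpha>) (Alex H \<beta>)" and "h \<in> quandle_hom (Conj G \<alpha>) (Conj H \<beta>)"
proof -
  have "\<alpha> x \<in> carrier G" if "x \<in> carrier G" for x
    using assms(1) that by (auto simp: hom_def)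
  then show "h \<in> quandle_hom (Alex G \<alpha>) (Alex H \<beta>)" "h \<in> quandle_hom (Conj G \<alpha>) (Conj H \<beta>)"
    by (auto simp: quandle_hom_def Alex_def Conj_def assms(2))
qed

lemma (in group) invariant_subgroup_subquandle:
  assumes "subgroup H G" and "\<alpha> \<in> iso G G" and "\<alpha> ` H = H"
  shows "subquandle (Alex (G\<lparr>carrier := H\<rparr>) (restrict \<alpha> H)) (Alex G \<alpha>)"
    and "subquandle (Conj (G\<lparr>carrier := H\<rparr>) (restrict \<alpha> H)) (Conj G \<alpha>)"
proof -
  let ?H = "G\<lparr>carrier := H\<rparr>"
  interpret H: subgroup H G by (rule assms(1))
  interpret GH: group ?H
    using assms(1) by (simp add: subgroup_imp_group)
  have "inj_on \<alpha> H"
    using assms(2) H.subset by (auto simp: iso_def bij_betw_def intro: inj_on_subset)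
  then have iso: "restrict \<alpha> H \<in> iso ?H ?H"
    using assms(2,3) by (auto simp: iso_def hom_def bij_betw_def)
  have "inv\<^bsub>?H\<^esub> x = inv x" if "x \<in> H" for x
    using assms(1) that by (rule m_inv_consistent)
  then show "subquandle (Alex ?H (restrict \<alpha> H)) (Alex G \<alpha>)"
    and "subquandle (Conj ?H (restrict \<alpha> H)) (Conj G \<alpha>)"
    using GH.Alex_quandle[OF iso] GH.Conj_quandle[OF iso]
      Alex_quandle[OF assms(2)] Conj_quandle[OF assms(2)]
    by (auto simp: subquandle_def Alex_def Conj_def)
qed

text \<open>
  The separating map is kept; only the structures on its source and target change from groups
  to quandles, so it still separates the same point from the same set.
\<close>

lemma group_separable_imp_quandle_separable:
  assumes "group G" and "inner_automorphism \<alpha> G" and S: "group_separable S G"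
  shows "quandle_separable S (Alex G \<alpha>)" and "quandle_separable S (Conj G \<alpha>)"
proof -
  have \<alpha>: "\<alpha> \<in> hom G G"
    using assms(2) by (simp add: inner_automorphism_def iso_def)
  have "\<exists>(F :: nat monoid) \<phi> \<beta>. group F \<and> finite (carrier F) \<and> \<beta> \<in> iso F F \<and> \<phi> x \<notin> \<phi> ` S \<and>
      \<phi> \<in> quandle_hom (Alex G \<alpha>) (Alex F \<beta>) \<and> \<phi> \<in> quandle_hom (Conj G \<alpha>) (Conj F \<beta>)"
    if "x \<in> carrier G - S" for x
  proof -
    obtain F :: "nat monoid" and \<phi>
      where F: "group F" "finite (carrier F)" "\<phi> \<in> hom G F" "\<phi> x \<notin> \<phi> ` S"
      using S \<open>x \<in> carrier G - S\<close> unfolding group_separable_def by blast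
    obtain \<beta> where \<beta>: "\<beta> \<in> iso F F" "\<And>y. y \<in> carrier G \<Longrightarrow> \<phi> (\<alpha> y) = \<beta> (\<phi> y)"
      using inner_automorphism_push[OF assms(1) F(1,3) assms(2)] by blast
    interpret \<phi>: group_hom G F \<phi>
      using assms(1) F by (simp add: group_hom_def group_hom_axioms_def)
    show ?thesis
      using F \<beta>(1) \<phi>.equivariant_quandle_hom[OF \<alpha> \<beta>(2)] by blast
  qed
  note sep = this
  have sub: "S \<subseteq> carrier G"
    using S by (simp add: group_separable_def)
  show "quandle_separable S (Alex G \<alpha>)"
    unfolding quandle_separable_def carrier_Alex
  proof (intro conjI ballI)
    fix x assume "x \<in> carrier G - S"
    from sep[OF this] show "\<exists>(F :: nat quandle) \<phi>.
        quandle F \<and> finite (carrier F) \<and> \<phi> \<in> quandle_hom (Alex G \<alpha>) F \<and> \<phi> x \<notin> \<phi> ` S"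
      by (metis group.Alex_quandle carrier_Alex)
  qed (rule sub)
  show "quandle_separable S (Conj G \<alpha>)"
    unfolding quandle_separable_def carrier_Conj
  proof (intro conjI ballI)
    fix x assume "x \<in> carrier G - S"
    from sep[OF this] show "\<exists>(F :: nat quandle) \<phi>.
        quandle F \<and> finite (carrier F) \<and> \<phi> \<in> quandle_hom (Conj G \<alpha>) F \<and> \<phi> x \<notin> \<phi> ` S"
      by (metis group.Conj_quandle carrier_Conj)
  qed (rule sub)
qed

theorem proposition5p3:
  fixes G :: "('a, 'b) monoid_scheme" and H :: "'a set" and \<alpha> :: "'a \<Rightarrow> 'a"
  assumes "subgroup_separable G"
    and "finitely_generated_subgroup H G"
    and "inner_automorphism \<alpha> G"
    and "\<alpha> ` H = H"
  shows "(subquandle (Alex (G\<lparr>carrier := H\<rparr>) (restrict \<alpha> H)) (Alex G \<alpha>) \<and>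
          quandle_separable (carrier (Alex (G\<lparr>carrier := H\<rparr>) (restrict \<alpha> H))) (Alex G \<alpha>)) \<and>
         (subquandle (Conj (G\<lparr>carrier := H\<rparr>) (restrict \<alpha> H)) (Conj G \<alpha>) \<and>
          quandle_separable (carrier (Conj (G\<lparr>carrier := H\<rparr>) (restrict \<alpha> H))) (Conj G \<alpha>))"
proof -
  interpret group G
    using assms(1) by (simp add: subgroup_separable_def)
  have "subgroup H G"
    using assms(2) by (simp add: finitely_generated_subgroup_def)
  moreover have "\<alpha> \<in> iso G G"
    using assms(3) by (simp add: inner_automorphism_def)
  moreover have "group_separable H G"
    using assms(1,2) by (simp add: subgroup_separable_def)
  ultimately show ?thesis
    using invariant_subgroup_subquandle[OF _ _ assms(4)]
      group_separable_imp_quandle_separable[OF is_group assms(3)]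
    by (simp add: carrier_Alex carrier_Conj)
qed

end
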